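(* Let $\mathbb{R}^+=\,]0,+\infty[$, let $a,b:\mathbb{R}^+\times\mathbb{R}^2\to\mathbb{R}$ and let $$\mathscr{L}u=x\frac{\partial}{\partial x}\Big(a\,x\,\frac{\partial u}{\partial x}\Big)+b\,x\,\frac{\partial u}{\partial x}+x\frac{\partial u}{\partial y}-\frac{\partial u}{\partial t}.$$ Assume that $a,b,\frac{\partial a}{\partial x},\frac{\partial b}{\partial x}\in C^{\alpha}_{\rm loc}(\mathbb{R}^+\times\mathbb{R}^2)$ for some $\alpha\in\,]0,1]$ and that there exist positive constants $\lambda,\Lambda$ such that $\lambda\le a\le\Lambda$ and $|b|,|\frac{\partial}{\partial x}(x\,a)|,|\frac{\partial}{\partial x}(x\,b)|\le\Lambda$ on $\mathbb{R}^+\times\mathbb{R}^2$. Let $t_0<T$, let $\varphi:\mathbb{R}^+\times\mathbb{R}\to\mathbb{R}$, and let $u_1,u_2$ be classical solutions to the Cauchy problem $$\begin{cases}\mathscr{L}u=0,&(x,y,t)\in\mathbb{R}^+\times\mathbb{R}\times\,]t_0,T],\\ u(x_0,y_0,t_0)=\varphi(x_0,y_0),&(x_0,y_0)\in\mathbb{R}^+\times\mathbb{R}.\end{cases}$$ If there exist positive constants $M$ and $C$ such that $$|u_1(x,y,t)|+|u_2(x,y,t)|\le M\exp\Big(\big[C\big(\log(x^2+y^2+1)-\log x\big)+1\big]^2\Big)\qquad\text{for every }(x,y,t)\in\mathbb{R}^+\times\mathbb{R}\times\,]t_0,T],$$ then $u_1=u_2$ in $\mathbb{R}^+\times\mathb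b{R}\times\,]t_0,T]$.
   Context: $C^\alpha_{\rm loc}(\mathbb{R}^+\times\mathbb{R}^2)$ is the usual Euclidean space of functions that are Hölder continuous with exponent $\alpha$ on every compact subset of $\mathbb{R}^+\times\mathbb{R}^2$. For $Y=x\partial_y-\partial_t$ the Lie derivative is $Yu(x,y,t):=\lim_{s\to0}\frac{u(x,y+sx,t-s)-u(x,y,t)}{s}$ (one-sided at the final time $t=T$); in $\mathscr{L}u$ the expression $x\partial_yu-\partial_tu$ is understood as $Yu$. A classical solution of $\mathscr{L}u=0$ in a set is a function $u$ such that $x\partial_xu$, $x^2\partial_x^2u$ and $Yu$ exist as continuous functions there and the equation holds at every point. The initial condition means that $u(x,y,t)\to\varphi(x_0,y_0)$ as $(x,y,t)\to(x_0,y_0,t_0)$ with $t>t_0$, for every $(x_0,y_0)\in\mathbb{R}^+\times\mathbb{R}$. *)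

theory Defs
  imports "HOL-Analysis.Analysis"
begin

text \<open>Points \<open>(x, y, t)\<close> of \<open>\<real>\<^sup>3\<close> are nested pairs; \<open>dist\<close> on them is the Euclidean distance.\<close>

definition pos_space :: "(real \<times> real \<times> real) set" where
  "pos_space = {(x, y, t). 0 < x}"

definition strip :: "real \<Rightarrow> real \<Rightarrow> (real \<times> real \<times> real) set" where
  "strip t0 T = {(x, y, t). 0 < x \<and> t0 < t \<and> t \<le> T}"

definition holder_loc :: "real \<Rightarrow> (real \<times> real \<times> real) set \<Rightarrow> (real \<times> real \<times> real \<Rightarrow> real) \<Rightarrow> bool" where
  "holder_loc \<alpha> S f \<longleftrightarrow>
     (\<forall>K. compact K \<and> K \<subseteq> S \<longrightarrow>
        (\<exists>H. \<forall>p\<in>K. \<forall>q\<in>K. \<bar>f p - f q\<bar> \<le> H * dist p q powr \<alpha>))"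

definition dx :: "(real \<times> real \<times> real \<Rightarrow> real) \<Rightarrow> real \<times> real \<times> real \<Rightarrow> real" where
  "dx f = (\<lambda>(x, y, t). deriv (\<lambda>s. f (s, y, t)) x)"

definition dx_exists_on :: "(real \<times> real \<times> real) set \<Rightarrow> (real \<times> real \<times> real \<Rightarrow> real) \<Rightarrow> bool" where
  "dx_exists_on S f \<longleftrightarrow>
     (\<forall>(x, y, t)\<in>S. (\<lambda>s. f (s, y, t)) field_differentiable at x)"

text \<open>The Lie derivative along \<open>Y = x \<partial>\<^sub>y - \<partial>\<^sub>t\<close>. The increment \<open>s\<close> ranges over the values for
  which the shifted point stays in \<open>\<Omega>\<close>; on \<open>strip t0 T\<close> this is the two-sided limit for
  \<open>t < T\<close> and the limit over \<open>s > 0\<close> for \<open>t = T\<close>.\<close>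

definition Y_filter :: "(real \<times> real \<times> real) set \<Rightarrow> real \<times> real \<times> real \<Rightarrow> real filter" where
  "Y_filter \<Omega> = (\<lambda>(x, y, t). at 0 within {s. (x, y + s * x, t - s) \<in> \<Omega>})"

definition Y_quot :: "(real \<times> real \<times> real \<Rightarrow> real) \<Rightarrow> real \<times> real \<times> real \<Rightarrow> real \<Rightarrow> real" where
  "Y_quot u = (\<lambda>(x, y, t) s. (u (x, y + s * x, t - s) - u (x, y, t)) / s)"

definition lieY :: "(real \<times> real \<times> real) set \<Rightarrow> (real \<times> real \<times> real \<Rightarrow> real) \<Rightarrow> real \<times> real \<times> real \<Rightarrow> real" where
  "lieY \<Omega> u p = Lim (Y_filter \<Omega> p) (Y_quot u p)"

definition lieY_exists_on :: "(real \<times> real \<times> real) set \<Rightarrow> (real \<times> real \<times> real \<Rightarrow> real) \<Rightarrow> bool" where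
  "lieY_exists_on \<Omega> u \<longleftrightarrow> (\<forall>p\<in>\<Omega>. \<exists>l. (Y_quot u p \<longlongrightarrow> l) (Y_filter \<Omega> p))"

text \<open>\<open>\<L>u = x \<partial>\<^sub>x (a x \<partial>\<^sub>x u) + b x \<partial>\<^sub>x u + Y u\<close>; the coordinate \<open>x\<close> is \<open>fst\<close>.\<close>

definition Lop :: "(real \<times> real \<times> real \<Rightarrow> real) \<Rightarrow> (real \<times> real \<times> real \<Rightarrow> real) \<Rightarrow>
    (real \<times> real \<times> real) set \<Rightarrow> (real \<times> real \<times> real \<Rightarrow> real) \<Rightarrow> real \<times> real \<times> real \<Rightarrow> real" where
  "Lop a b \<Omega> u p =
     fst p * dx (\<lambda>q. a q * fst q * dx u q) p + b p * fst p * dx u p + lieY \<Omega> u p"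

definition classical_solution :: "(real \<times> real \<times> real \<Rightarrow> real) \<Rightarrow> (real \<times> real \<times> real \<Rightarrow> real) \<Rightarrow>
    (real \<times> real \<times> real) set \<Rightarrow> (real \<times> real \<times> real \<Rightarrow> real) \<Rightarrow> bool" where
  "classical_solution a b \<Omega> u \<longleftrightarrow>
     dx_exists_on \<Omega> u \<and> continuous_on \<Omega> (\<lambda>p. fst p * dx u p) \<and>
     dx_exists_on \<Omega> (dx u) \<and> continuous_on \<Omega> (\<lambda>p. (fst p)\<^sup>2 * dx (dx u) p) \<and>
     lieY_exists_on \<Omega> u \<and> continuous_on \<Omega> (lieY \<Omega> u) \<and>
     (\<forall>p\<in>\<Omega>. Lop a b \<Omega> u p = 0)"

text \<open>A solution is only considered on \<open>strip t0 T\<close>, so the initial datum is attained as a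
  limit from inside the strip.\<close>

definition cauchy_solution :: "(real \<times> real \<times> real \<Rightarrow> real) \<Rightarrow> (real \<times> real \<times> real \<Rightarrow> real) \<Rightarrow>
    real \<Rightarrow> real \<Rightarrow> (real \<times> real \<Rightarrow> real) \<Rightarrow> (real \<times> real \<times> real \<Rightarrow> real) \<Rightarrow> bool" where
  "cauchy_solution a b t0 T \<phi> u \<longleftrightarrow>
     classical_solution a b (strip t0 T) u \<and>
     (\<forall>x0 y0. 0 < x0 \<longrightarrow> (u \<longlongrightarrow> \<phi> (x0, y0)) (at (x0, y0, t0) within strip t0 T))"

end

theory Submission
  imports Defs
begin

text \<open>
  With \<open>g = log (x\<^sup>2 + y\<^sup>2 + 1) - log x\<close>, the quantities \<open>x \<partial>\<^sub>x g\<close>, \<open>x\<^sup>2 \<partial>\<^sub>x\<^sup>2 g\<close> (from above) and \<open>x \<partial>\<^sub>y g\<close>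
  are bounded. Hence, for \<open>\<beta>\<close> large, \<open>H = exp ((1 + \<beta> (t - \<tau>)) (2 C g + 1)\<^sup>2)\<close> satisfies
  \<open>\<L> H < 0\<close> on the time slab \<open>\<tau> \<le> t \<le> \<tau> + 1 / \<beta>\<close>, where it also outgrows the bound on
  \<open>w = u\<^sub>1 - u\<^sub>2\<close>. If \<open>w \<le> 0\<close> up to time \<open>\<tau>\<close>, then for every \<open>\<epsilon> > 0\<close> the set \<open>w \<ge> \<epsilon> H\<close> within
  \<open>t \<le> \<tau> + 1 / \<beta>\<close> is compact, so if \<open>w - \<epsilon> H\<close> were positive somewhere it would have a maximum,
  at which the equation fails. Thus \<open>w \<le> 0\<close> up to time \<open>\<tau> + 1 / \<beta>\<close>, and one iterates from
  \<open>\<tau> = t\<^sub>0\<close>. That \<open>u\<^sub>1, u\<^sub>2\<close> are continuous is not assumed: it follows because \<open>\<partial>\<^sub>x\<close>, \<open>Y\<close> and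
  their commutator \<open>\<partial>\<^sub>y\<close> span all directions.
\<close>

section \<open>Continuity from \<open>\<partial>\<^sub>x\<close> and the Lie derivative\<close>

lemma mem_strip [simp]: "(x, y, t) \<in> strip t0 T \<longleftrightarrow> 0 < x \<and> t0 < t \<and> t \<le> T"
  by (simp add: strip_def)

text \<open>The flow keeps \<open>x\<close> fixed and \<open>y\<close> is unrestricted, so only
  \<open>t0 < t - s\<close> and \<open>t - s \<le> T\<close> constrain \<open>s\<close>. At
  \<open>t = T\<close> the left end is 0, which gives the one-sided limit.\<close>

lemma Y_filter_strip:
  "0 < x \<Longrightarrow> Y_filter (strip t0 T) (x, y, t) = at 0 within {t - T..<t - t0}"
  unfolding Y_filter_def prod.case by (rule arg_cong[where f = "at_within 0"]) auto

text \<open>Small positive increments lead to earlier times and are always admissible, also at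
  \<open>t = T\<close>. This makes limits along the filter unique, so \<open>Lim\<close> in
  \<open>lieY\<close> is the actual limit.\<close>

lemma Y_filter_strip_nontrivial:
  assumes "(x, y, t) \<in> strip t0 T"
  shows "Y_filter (strip t0 T) (x, y, t) \<noteq> bot"
proof -
  have "at (0::real) within {0<..<t - t0} \<noteq> bot"
    using assms by (simp add: trivial_limit_within islimpt_greaterThanLessThan1)
  moreover have "at 0 within {0<..<t - t0} \<le> at 0 within {t - T..<t - t0}"
    using assms by (intro at_le) auto
  ultimately show ?thesis
    using assms by (auto simp: Y_filter_strip bot_unique)
qed

lemma tendsto_lieY:
  assumes "lieY_exists_on (strip t0 T) u" "p \<in> strip t0 T"
  shows "(Y_quot u p \<longlongrightarrow> lieY (strip t0 T) u p) (Y_filter (strip t0 T) p)"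
proof -
  obtain l where l: "(Y_quot u p \<longlongrightarrow> l) (Y_filter (strip t0 T) p)"
    using assms unfolding lieY_exists_on_def by blast
  have "Y_filter (strip t0 T) p \<noteq> bot"
    using assms(2) Y_filter_strip_nontrivial by (cases p) auto
  then show ?thesis
    using l tendsto_Lim unfolding lieY_def by metis
qed

text \<open>Since \<open>x\<close> is constant along the flow, the flow is a translation in its
  parameter: the step from parameter \<open>s\<close> to \<open>r\<close> is the step
  \<open>r - s\<close> from the shifted point. Hence the Lie derivative at one point is the
  derivative of \<open>u\<close> along the whole curve at the matching parameter.\<close>

lemma has_real_derivative_along_Y:
  assumes "lieY_exists_on (strip t0 T) u" "(x, y + s * x, t - s) \<in> strip t0 T"
  shows "((\<lambda>s. u (x, y + s * x, t - s)) has_real_derivative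
           lieY (strip t0 T) u (x, y + s * x, t - s)) (at s within {t - T..<t - t0})"
proof -
  have im: "(\<lambda>h. h + s) ` {t - s - T..<t - s - t0} = {t - T..<t - t0}"
    by (simp add: image_add_atLeastLessThan')
  have "(Y_quot u (x, y + s * x, t - s) \<longlongrightarrow> lieY (strip t0 T) u (x, y + s * x, t - s))
          (at 0 within {t - s - T..<t - s - t0})"
    using tendsto_lieY[OF assms] assms(2) by (simp add: Y_filter_strip)
  moreover have "filterlim (\<lambda>r. r - s) (at 0 within {t - s - T..<t - s - t0})
                   (at s within {t - T..<t - t0})"
    unfolding filterlim_at
    by (auto simp: eventually_at_filter intro!: tendsto_eq_intros)
  ultimately have "((\<lambda>r. Y_quot u (x, y + s * x, t - s) (r - s)) \<longlongrightarrow>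
        lieY (strip t0 T) u (x, y + s * x, t - s)) (at s within {t - T..<t - t0})"
    by (rule filterlim_compose)
  then show ?thesis
    by (simp add: has_field_derivative_iff Y_quot_def algebra_simps)
qed

lemma has_real_derivative_dx:
  assumes "dx_exists_on S u" "(x, y, t) \<in> S"
  shows "((\<lambda>s. u (s, y, t)) has_real_derivative dx u (x, y, t)) (at x)"
  using bspec[OF assms(1)[unfolded dx_exists_on_def] assms(2)]
  by (simp add: dx_def DERIV_deriv_iff_field_differentiable)

section \<open>Lipschitz bounds in the two directions and continuity\<close>

lemma lipschitz_along_Y:
  assumes Y: "lieY_exists_on (strip t0 T) u"
    and p: "(x, y, t) \<in> strip t0 T" "(x, y + s * x, t - s) \<in> strip t0 T"
    and B: "\<And>r. r \<in> closed_segment 0 s \<Longrightarrow> \<bar>lieY (strip t0 T) u (x, y + r * x, t - r)\<bar> \<le> B"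
  shows "\<bar>u (x, y + s * x, t - s) - u (x, y, t)\<bar> \<le> B * \<bar>s\<bar>"
proof -
  have sub: "closed_segment 0 s \<subseteq> {t - T..<t - t0}"
    using p by (auto simp: closed_segment_eq_real_ivl)
  have "((\<lambda>s. u (x, y + s * x, t - s)) has_real_derivative
           lieY (strip t0 T) u (x, y + r * x, t - r)) (at r within closed_segment 0 s)"
    if "r \<in> closed_segment 0 s" for r
    using that sub p
    by (intro DERIV_subset[OF has_real_derivative_along_Y[OF Y] sub]) auto
  from field_differentiable_bound[OF convex_closed_segment this, where B = B and x = s and y = 0]
  show ?thesis using B by simp
qed

lemma lipschitz_in_x:
  assumes X: "dx_exists_on (strip t0 T) u"
    and p: "(x, y, t) \<in> strip t0 T" "(x', y, t) \<in> strip t0 T"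
    and B: "\<And>r. r \<in> closed_segment x x' \<Longrightarrow> \<bar>dx u (r, y, t)\<bar> \<le> B"
  shows "\<bar>u (x', y, t) - u (x, y, t)\<bar> \<le> B * \<bar>x' - x\<bar>"
proof -
  have "((\<lambda>s. u (s, y, t)) has_real_derivative dx u (r, y, t)) (at r within closed_segment x x')"
    if "r \<in> closed_segment x x'" for r
  proof -
    have "(r, y, t) \<in> strip t0 T"
      using that p by (auto simp: closed_segment_eq_real_ivl split: if_splits)
    then show ?thesis
      by (rule has_field_derivative_at_within[OF has_real_derivative_dx[OF X]])
  qed
  from field_differentiable_bound[OF convex_closed_segment this, where B = B and x = x' and y = x]
  show ?thesis using B by simp
qed

text \<open>A point \<open>q\<close> near \<open>p\<close> is joined to \<open>p\<close> inside the strip by flowing both back along \<open>Y\<close> to the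
  common time \<open>t' - s\<close>; the starting abscissa \<open>\<xi>\<close> of the flow from \<open>q\<close> is chosen so that the
  \<open>y\<close>-coordinates agree there. As \<open>q \<rightarrow> p\<close> with \<open>s\<close> fixed, \<open>\<xi> \<rightarrow> x\<close>, and the flow contributes \<open>O(s)\<close>.\<close>

lemma continuous_on_strip_if_dx_lieY:
  assumes X: "dx_exists_on (strip t0 T) u" "continuous_on (strip t0 T) (dx u)"
    and Y: "lieY_exists_on (strip t0 T) u" "continuous_on (strip t0 T) (lieY (strip t0 T) u)"
  shows "continuous_on (strip t0 T) u"
  unfolding continuous_on_iff
proof (intro ballI allI impI)
  fix p :: "real \<times> real \<times> real" and e :: real
  assume p: "p \<in> strip t0 T" and e: "0 < e"
  obtain x y t where pe: "p = (x, y, t)" by (cases p)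
  have xt: "0 < x" "t0 < t" "t \<le> T" using p by (auto simp: pe)
  \<comment> \<open>On the box of radius \<open>r\<close> chosen below, \<open>dx u\<close> and the
    Lie derivative differ from their values at \<open>p\<close> by less than 1, so \<open>B\<close>
    bounds both.\<close>
  define B where "B = max \<bar>dx u p\<bar> \<bar>lieY (strip t0 T) u p\<bar> + 1"
  have B: "0 < B" by (auto simp: B_def)
  obtain d1 where d1: "0 < d1" "\<And>q. q \<in> strip t0 T \<Longrightarrow> dist q p < d1 \<Longrightarrow> dist (dx u q) (dx u p) < 1"
    using X(2) p unfolding continuous_on_iff by (metis zero_less_one)
  obtain d2 where d2: "0 < d2" "\<And>q. q \<in> strip t0 T \<Longrightarrow> dist q p < d2 \<Longrightarrow>
      dist (lieY (strip t0 T) u q) (lieY (strip t0 T) u p) < 1"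
    using Y(2) p unfolding continuous_on_iff by (metis zero_less_one)
  \<comment> \<open>The factor 1/3 appears because a distance is at most the sum of three coordinate
    differences; \<open>x / 2\<close> and \<open>(t - t0) / 2\<close> keep the box away from
    \<open>x = 0\<close> and from the initial time. The top \<open>t = T\<close> may contain
    \<open>p\<close>, so \<open>bnd\<close> asks for \<open>\<rho> \<le> T\<close> instead.\<close>
  define r where "r = Min {d1 / 3, d2 / 3, x / 2, (t - t0) / 2}"
  have r0: "0 < r" using d1 d2 xt by (simp add: r_def)
  have r: "r \<le> d1 / 3" "r \<le> d2 / 3" "r \<le> x / 2" "r \<le> (t - t0) / 2"
    unfolding r_def by (rule Min_le; simp)+
  note r = r0 r
  have bnd: "(\<xi>, \<eta>, \<rho>) \<in> strip t0 T \<and> \<bar>dx u (\<xi>, \<eta>, \<rho>)\<bar> \<le> B \<and> \<bar>lieY (strip t0 T) u (\<xi>, \<eta>, \<rho>)\<bar> \<le> B"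
    if "\<bar>\<xi> - x\<bar> < r" "\<bar>\<eta> - y\<bar> < r" "\<bar>\<rho> - t\<bar> < r" "\<rho> \<le> T" for \<xi> \<eta> \<rho>
  proof -
    have "dist (\<xi>, \<eta>, \<rho>) p \<le> dist \<xi> x + (dist \<eta> y + dist \<rho> t)"
      unfolding pe dist_Pair_Pair
      by (rule order_trans[OF sqrt_sum_squares_le_sum_abs])
         (auto intro: order_trans[OF sqrt_sum_squares_le_sum_abs])
    then have "dist (\<xi>, \<eta>, \<rho>) p < 3 * r"
      using that by (simp add: dist_real_def)
    moreover have "(\<xi>, \<eta>, \<rho>) \<in> strip t0 T"
      using that r xt by auto
    ultimately show ?thesis
      using d1(2)[of "(\<xi>, \<eta>, \<rho>)"] d2(2)[of "(\<xi>, \<eta>, \<rho>)"] r by (auto simp: B_def dist_real_def)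
  qed
  \<comment> \<open>The three entries keep the flow for time up to \<open>2 * s\<close> inside the
    box, in \<open>t\<close> and in \<open>y\<close>, and make its contribution to the change of
    \<open>u\<close> a fraction of \<open>e\<close>.\<close>
  define s where "s = Min {r / 4, r / (8 * x), e / (8 * B)}"
  have s0: "0 < s" using r xt e B by (simp add: s_def)
  have s: "s \<le> r / 4" "s \<le> r / (8 * x)" "s \<le> e / (8 * B)"
    unfolding s_def by (rule Min_le; simp)+
  note s = s0 s
  have sx: "s * x \<le> r / 8" and sB: "B * s \<le> e / 8"
    using s xt B by (auto simp: field_simps)
  \<comment> \<open>\<open>d\<close> is chosen after \<open>s\<close>, because the shift of the
    abscissa costs \<open>d * (1 + x) / s\<close>. The entry \<open>s / 2\<close> keeps the flow
    time \<open>\<rho>\<close> from \<open>p\<close> positive and at most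
    \<open>2 * s\<close>.\<close>
  define d where "d = Min {s / 2, r / 4, e / (8 * B), s * r / (4 * (1 + x)), s * e / (8 * B * (1 + x))}"
  have d0: "0 < d" using s r xt e B by (simp add: d_def)
  have d: "d \<le> s / 2" "d \<le> r / 4" "d \<le> e / (8 * B)" "d \<le> s * r / (4 * (1 + x))"
      "d \<le> s * e / (8 * B * (1 + x))"
    unfolding d_def by (rule Min_le; simp)+
  note d = d0 d
  have "dist (u q) (u p) < e" if q: "q \<in> strip t0 T" "dist q p < d" for q
  proof -
    obtain x' y' t' where qe: "q = (x', y', t')" by (cases q)
    have x't: "0 < x'" "t0 < t'" "t' \<le> T" using q by (auto simp: qe)
    have "dist x' x \<le> dist q p" "dist (y', t') (y, t) \<le> dist q p"
      using dist_fst_le[of q p] dist_snd_le[of q p] by (auto simp: qe pe)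
    moreover have "dist y' y \<le> dist (y', t') (y, t)" "dist t' t \<le> dist (y', t') (y, t)"
      using dist_fst_le[of "(y', t')" "(y, t)"] dist_snd_le[of "(y', t')" "(y, t)"] by auto
    ultimately have near: "\<bar>x' - x\<bar> < d" "\<bar>y' - y\<bar> < d" "\<bar>t' - t\<bar> < d"
      using q(2) by (auto simp: dist_real_def)
    \<comment> \<open>\<open>k\<close> solves \<open>y' + s * (x + k) = y + \<rho> * x\<close> with
      \<open>\<rho> = s - (t' - t)\<close>: the flows from \<open>(\<xi>, y', t')\<close> and from
      \<open>p\<close> then end at the same \<open>y\<close> and the same time.\<close>
    define k where "k = (y - y' - (t' - t) * x) / s"
    define \<xi> where "\<xi> = x + k"
    define \<rho> where "\<rho> = s - (t' - t)"
    have \<rho>: "0 < \<rho>" "\<rho> \<le> 2 * s"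
      using near d s by (auto simp: \<rho>_def)
    have ks: "k * s = y - y' - (t' - t) * x"
      using s by (simp add: k_def)
    have "\<bar>k\<bar> * s = \<bar>y - y' - (t' - t) * x\<bar>"
      using s ks by (metis abs_mult abs_of_pos)
    also have "\<dots> \<le> \<bar>y - y'\<bar> + \<bar>t' - t\<bar> * x"
      using xt abs_triangle_ineq4[of "y - y'" "(t' - t) * x"] by (simp add: abs_mult)
    also have "\<dots> \<le> d + d * x"
      using near xt by (intro add_mono mult_right_mono) auto
    finally have k1: "\<bar>k\<bar> * s \<le> d * (1 + x)" by (simp add: algebra_simps)
    have "d * (1 + x) \<le> s * r / 4" "d * (1 + x) \<le> s * e / (8 * B)"
      using d(5,6) xt by (simp_all only: pos_le_divide_eq divide_divide_eq_left[symmetric] add_pos_pos zero_less_one)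
    with k1 have "\<bar>k\<bar> * s \<le> (r / 4) * s" "\<bar>k\<bar> * s \<le> (e / (8 * B)) * s"
      by (auto simp: algebra_simps)
    then have k: "\<bar>k\<bar> \<le> r / 4" "\<bar>k\<bar> \<le> e / (8 * B)"
      using s(1) by (simp_all only: mult_le_cancel_right_pos)
    have kB: "B * \<bar>k\<bar> \<le> e / 8" and dB: "B * d \<le> e / 8"
      using k(2) d(4) B by (auto simp: field_simps)
    have flow\<xi>: "\<bar>h * \<xi>\<bar> \<le> r / 4" if "0 \<le> h" "h \<le> s" for h
    proof -
      have "\<bar>h * \<xi>\<bar> \<le> h * (2 * x)"
        using that k r xt by (auto simp: abs_mult \<xi>_def intro!: mult_left_mono)
      also have "\<dots> \<le> s * (2 * x)" using that xt by (intro mult_right_mono) auto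
      finally show ?thesis using sx by simp
    qed
    have flowx: "\<bar>h * x\<bar> \<le> r / 4" if "0 \<le> h" "h \<le> \<rho>" for h
    proof -
      have "h * x \<le> 2 * s * x" using that \<rho> xt by (intro mult_right_mono) auto
      also have "\<dots> \<le> r / 4" using sx by simp
      finally show ?thesis using that xt by (simp add: abs_mult)
    qed
    \<comment> \<open>The path from \<open>q\<close> to \<open>p\<close> has four legs: along
      \<open>x\<close> to \<open>\<xi>\<close>, back along the flow for time \<open>s\<close>, along
      \<open>x\<close> from \<open>\<xi>\<close> to \<open>x\<close>, and forward in time along the
      flow to \<open>p\<close>. Facts 1, 2, 4 and 3 bound them in this order.\<close>
    have 1: "\<bar>u (\<xi>, y', t') - u (x', y', t')\<bar> \<le> B * \<bar>\<xi> - x'\<bar>"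
    proof (rule lipschitz_in_x[OF X(1)])
      show "\<bar>dx u (h, y', t')\<bar> \<le> B" if "h \<in> closed_segment x' \<xi>" for h
      proof -
        have "\<bar>h - x\<bar> < r"
          using that near k d r by (auto simp: closed_segment_eq_real_ivl \<xi>_def split: if_splits)
        then show ?thesis using bnd[of h y' t'] near d r x't by auto
      qed
      show "(\<xi>, y', t') \<in> strip t0 T" using bnd[of \<xi> y' t'] near k d r x't by (auto simp: \<xi>_def)
    qed (use x't in auto)
    have box2: "\<bar>lieY (strip t0 T) u (\<xi>, y' + h * \<xi>, t' - h)\<bar> \<le> B \<and> (\<xi>, y' + h * \<xi>, t' - h) \<in> strip t0 T"
      if "0 \<le> h" "h \<le> s" for h
    proof -
      have "\<bar>\<xi> - x\<bar> < r" using k r0 by (simp add: \<xi>_def)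
      moreover have "\<bar>y' + h * \<xi> - y\<bar> < r" using flow\<xi>[OF that] near(2) d(3) r0 by linarith
      moreover have "\<bar>t' - h - t\<bar> < r" using near(3) d(3) s(2) r0 that by linarith
      moreover have "t' - h \<le> T" using x't that by linarith
      ultimately show ?thesis using bnd by blast
    qed
    have 2: "\<bar>u (\<xi>, y' + s * \<xi>, t' - s) - u (\<xi>, y', t')\<bar> \<le> B * \<bar>s\<bar>"
      by (rule lipschitz_along_Y[OF Y(1)])
         (use box2[of 0] box2[of s] s box2 in \<open>auto simp: closed_segment_eq_real_ivl\<close>)
    have box3: "\<bar>lieY (strip t0 T) u (x, y + h * x, t - h)\<bar> \<le> B \<and> (x, y + h * x, t - h) \<in> strip t0 T"
      if "0 \<le> h" "h \<le> \<rho>" for h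
    proof -
      have "\<bar>y + h * x - y\<bar> < r" using flowx[OF that] r0 by linarith
      moreover have "\<bar>t - h - t\<bar> < r" using s(2) r0 \<rho> that by linarith
      moreover have "t - h \<le> T" using xt that by linarith
      moreover have "\<bar>x - x\<bar> < r" using r0 by simp
      ultimately show ?thesis using bnd by blast
    qed
    have 3: "\<bar>u (x, y + \<rho> * x, t - \<rho>) - u (x, y, t)\<bar> \<le> B * \<bar>\<rho>\<bar>"
      by (rule lipschitz_along_Y[OF Y(1)])
         (use box3[of 0] box3[of \<rho>] \<rho> box3 in \<open>auto simp: closed_segment_eq_real_ivl\<close>)
    have same: "y + \<rho> * x = y' + s * \<xi>" "t - \<rho> = t' - s"
      using ks by (auto simp: \<rho>_def \<xi>_def algebra_simps)
    have 4: "\<bar>u (x, y' + s * \<xi>, t' - s) - u (\<xi>, y' + s * \<xi>, t' - s)\<bar> \<le> B * \<bar>x - \<xi>\<bar>"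
    proof (rule lipschitz_in_x[OF X(1)])
      show "\<bar>dx u (h, y' + s * \<xi>, t' - s)\<bar> \<le> B" if "h \<in> closed_segment \<xi> x" for h
      proof -
        have "\<bar>h - x\<bar> < r"
          using that k r by (auto simp: closed_segment_eq_real_ivl \<xi>_def split: if_splits)
        moreover have "\<bar>y' + s * \<xi> - y\<bar> < r" using flow\<xi>[of s] near(2) d(3) s(1) r0 by linarith
        moreover have "\<bar>t' - s - t\<bar> < r" using near(3) d(3) s(1,2) r0 by linarith
        moreover have "t' - s \<le> T" using x't s(1) by linarith
        ultimately show ?thesis using bnd by blast
      qed
      show "(\<xi>, y' + s * \<xi>, t' - s) \<in> strip t0 T" using box2[of s] s by auto
      show "(x, y' + s * \<xi>, t' - s) \<in> strip t0 T" using box3[of \<rho>] \<rho> same by simp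
    qed
    have "B * \<bar>\<xi> - x'\<bar> \<le> B * (\<bar>k\<bar> + d)"
      using near(1) B by (intro mult_left_mono) (simp_all add: \<xi>_def)
    then have b1: "B * \<bar>\<xi> - x'\<bar> \<le> e / 4"
      using kB dB by (simp add: distrib_left)
    have b2: "B * \<bar>s\<bar> \<le> e / 8" using sB s(1) by simp
    have "B * \<bar>\<rho>\<bar> \<le> B * (2 * s)" using \<rho> B by (intro mult_left_mono) simp_all
    then have b3: "B * \<bar>\<rho>\<bar> \<le> e / 4" using sB by simp
    have b4: "B * \<bar>x - \<xi>\<bar> \<le> e / 8" using kB by (simp add: \<xi>_def)
    have "\<bar>u (x', y', t') - u (x, y, t)\<bar> \<le> e / 4 + e / 8 + e / 4 + e / 8"
      using order_trans[OF 1 b1] order_trans[OF 2 b2] order_trans[OF 3[unfolded same] b3]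
        order_trans[OF 4 b4] by linarith
    also have "\<dots> < e" using e by simp
    finally show ?thesis by (simp add: qe pe dist_real_def)
  qed
  then show "\<exists>d>0. \<forall>q\<in>strip t0 T. dist q p < d \<longrightarrow> dist (u q) (u p) < e"
    using d by blast
qed

section \<open>The barrier\<close>

text \<open>This is \<open>ln (2 * cosh d)\<close>, where \<open>d\<close> is the hyperbolic
  distance from \<open>(x, y)\<close> to \<open>(1, 0)\<close> in the half-plane with height
  \<open>x\<close>.\<close>

definition potential :: "real \<Rightarrow> real \<Rightarrow> real" where
  "potential x y = ln (x\<^sup>2 + y\<^sup>2 + 1) - ln x"

text \<open>The coefficient growing in time makes \<open>- \<partial>_t\<close> produce a term
  \<open>- \<beta>\<close> times the square of \<open>K * potential x y + 1\<close>, of the same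
  order as the largest spatial terms.\<close>

definition barrier :: "real \<Rightarrow> real \<Rightarrow> real \<Rightarrow> real \<times> real \<times> real \<Rightarrow> real" where
  "barrier K \<beta> \<tau> = (\<lambda>(x, y, t). exp ((1 + \<beta> * (t - \<tau>)) * (K * potential x y + 1)\<^sup>2))"

definition barrier_x :: "real \<Rightarrow> real \<Rightarrow> real \<Rightarrow> real \<times> real \<times> real \<Rightarrow> real" where
  "barrier_x K \<beta> \<tau> = (\<lambda>(x, y, t). barrier K \<beta> \<tau> (x, y, t) *
     (2 * (1 + \<beta> * (t - \<tau>)) * (K * potential x y + 1) * K * (2 * x / (x\<^sup>2 + y\<^sup>2 + 1) - 1 / x)))"

text \<open>The form is that of \<open>H'' / H\<close>, namely the square of the logarithmic
  derivative plus its derivative; the latter gives the last two summands.\<close>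

definition barrier_xx :: "real \<Rightarrow> real \<Rightarrow> real \<Rightarrow> real \<times> real \<times> real \<Rightarrow> real" where
  "barrier_xx K \<beta> \<tau> = (\<lambda>(x, y, t). barrier K \<beta> \<tau> (x, y, t) *
     ((2 * (1 + \<beta> * (t - \<tau>)) * (K * potential x y + 1) * K * (2 * x / (x\<^sup>2 + y\<^sup>2 + 1) - 1 / x))\<^sup>2
      + 2 * (1 + \<beta> * (t - \<tau>)) * K\<^sup>2 * (2 * x / (x\<^sup>2 + y\<^sup>2 + 1) - 1 / x)\<^sup>2
      + 2 * (1 + \<beta> * (t - \<tau>)) * (K * potential x y + 1) * K *
          (2 / (x\<^sup>2 + y\<^sup>2 + 1) - 4 * x\<^sup>2 / (x\<^sup>2 + y\<^sup>2 + 1)\<^sup>2 + 1 / x\<^sup>2)))"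

definition barrier_Y :: "real \<Rightarrow> real \<Rightarrow> real \<Rightarrow> real \<times> real \<times> real \<Rightarrow> real" where
  "barrier_Y K \<beta> \<tau> = (\<lambda>(x, y, t). barrier K \<beta> \<tau> (x, y, t) *
     (2 * (1 + \<beta> * (t - \<tau>)) * (K * potential x y + 1) * K * (2 * x * y / (x\<^sup>2 + y\<^sup>2 + 1))
      - \<beta> * (K * potential x y + 1)\<^sup>2))"

section \<open>Derivatives of the potential and of the barrier\<close>

lemma sum_squares_plus_one_pos [simp]: "0 < (x::real)\<^sup>2 + y\<^sup>2 + 1"
  by (simp add: add_nonneg_pos)

lemma sum_squares_plus_one_neq [simp]: "(x::real)\<^sup>2 + y\<^sup>2 + 1 \<noteq> 0"
  using sum_squares_plus_one_pos[of x y] by linarith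

lemma has_derivative_potential_x:
  "0 < x \<Longrightarrow> ((\<lambda>x. potential x y) has_real_derivative
     2 * x / (x\<^sup>2 + y\<^sup>2 + 1) - 1 / x) (at x)"
  unfolding potential_def by (auto intro!: derivative_eq_intros)

lemma has_derivative_potential_xx:
  assumes "0 < x"
  shows "((\<lambda>x. 2 * x / (x\<^sup>2 + y\<^sup>2 + 1) - 1 / x) has_real_derivative
     2 / (x\<^sup>2 + y\<^sup>2 + 1) - 4 * x\<^sup>2 / (x\<^sup>2 + y\<^sup>2 + 1)\<^sup>2 + 1 / x\<^sup>2) (at x)"
proof -
  define r where "r = (\<lambda>x::real. x\<^sup>2 + y\<^sup>2 + 1)"
  have r: "(r has_real_derivative 2 * x) (at x)" "r x \<noteq> 0"
    unfolding r_def by (auto intro!: derivative_eq_intros)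
  have "((\<lambda>x. 2 * x / r x) has_real_derivative (2 * r x - 2 * x * (2 * x)) / (r x * r x)) (at x)"
    by (rule derivative_eq_intros r refl | simp)+
  also have "(2 * r x - 2 * x * (2 * x)) / (r x * r x) = 2 / r x - 4 * x\<^sup>2 / (r x)\<^sup>2"
    using r by (simp add: diff_divide_distrib power2_eq_square)
  finally have 1: "((\<lambda>x. 2 * x / r x) has_real_derivative 2 / r x - 4 * x\<^sup>2 / (r x)\<^sup>2) (at x)" .
  have 2: "((\<lambda>x. 1 / x) has_real_derivative - (1 / x\<^sup>2)) (at x)"
    using assms by (auto intro!: derivative_eq_intros simp: power2_eq_square)
  show ?thesis
    using DERIV_diff[OF 1 2] by (simp add: r_def)
qed

lemma has_derivative_barrier_x:
  "0 < x \<Longrightarrow> ((\<lambda>x. barrier K \<beta> \<tau> (x, y, t)) has_real_derivative barrier_x K \<beta> \<tau> (x, y, t)) (at x)"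
  unfolding barrier_def barrier_x_def prod.case
  by (auto intro!: derivative_eq_intros has_derivative_potential_x)

lemma has_derivative_barrier_xx:
  assumes "0 < x"
  shows "((\<lambda>x. barrier_x K \<beta> \<tau> (x, y, t)) has_real_derivative barrier_xx K \<beta> \<tau> (x, y, t)) (at x)"
proof -
  define \<theta> where "\<theta> = 1 + \<beta> * (t - \<tau>)"
  define g1 where "g1 = (\<lambda>x::real. 2 * x / (x\<^sup>2 + y\<^sup>2 + 1) - 1 / x)"
  define g2 where "g2 = 2 / (x\<^sup>2 + y\<^sup>2 + 1) - 4 * x\<^sup>2 / (x\<^sup>2 + y\<^sup>2 + 1)\<^sup>2 + 1 / x\<^sup>2"
  have g: "((\<lambda>x. potential x y) has_real_derivative g1 x) (at x)" "(g1 has_real_derivative g2) (at x)"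
    using has_derivative_potential_x[OF assms] has_derivative_potential_xx[OF assms]
    by (simp_all add: g1_def g2_def)
  have "((\<lambda>x. 2 * \<theta> * (K * potential x y + 1) * K * g1 x) has_real_derivative
      2 * \<theta> * K\<^sup>2 * (g1 x)\<^sup>2 + 2 * \<theta> * (K * potential x y + 1) * K * g2) (at x)"
    by (auto intro!: derivative_eq_intros g) (simp add: algebra_simps power2_eq_square)
  note D = DERIV_mult[OF has_derivative_barrier_x[OF assms, of K \<beta> \<tau> y t] this]
  have eq: "2 * x / (x\<^sup>2 + y\<^sup>2 + 1) - 1 / x = g1 x" for x
    by (simp add: g1_def)
  show ?thesis
    using D
    unfolding barrier_x_def barrier_xx_def prod.case \<theta>_def[symmetric] g2_def[symmetric] eq
    by (rule DERIV_cong) (simp add: algebra_simps power2_eq_square)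
qed

lemma has_derivative_potential_Y:
  assumes "0 < x"
  shows "((\<lambda>s. potential x (y + s * x)) has_real_derivative
           2 * x * y / (x\<^sup>2 + y\<^sup>2 + 1)) (at 0)"
  unfolding potential_def using assms by (auto intro!: derivative_eq_intros)

lemma has_derivative_barrier_Y:
  assumes "0 < x"
  shows "((\<lambda>s. barrier K \<beta> \<tau> (x, y + s * x, t - s)) has_real_derivative
           barrier_Y K \<beta> \<tau> (x, y, t)) (at 0)"
proof -
  define m where "m = 2 * x * y / (x\<^sup>2 + y\<^sup>2 + 1)"
  have m: "((\<lambda>s. potential x (y + s * x)) has_real_derivative m) (at 0)"
    using has_derivative_potential_Y[OF assms] by (simp add: m_def)
  have "((\<lambda>s. (1 + \<beta> * (t - s - \<tau>)) * (K * potential x (y + s * x) + 1)\<^sup>2) has_real_derivative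
     2 * (1 + \<beta> * (t - \<tau>)) * (K * potential x y + 1) * K * m
      - \<beta> * (K * potential x y + 1)\<^sup>2) (at 0)"
    by (rule derivative_eq_intros m refl)+ (simp add: algebra_simps power2_eq_square)
  from DERIV_chain2[OF DERIV_exp this] show ?thesis
    by (simp add: barrier_Y_def barrier_def m_def)
qed

section \<open>Bounds on the potential and the sign of the operator on the barrier\<close>

lemma potential_pos:
  assumes "0 < x"
  shows "0 < potential x y"
proof -
  have "0 \<le> (x - 1)\<^sup>2" by simp
  then have "x < x\<^sup>2 + y\<^sup>2 + 1"
    using assms by (simp add: power2_diff) (smt (verit) zero_le_power2)
  then show ?thesis using assms by (simp add: potential_def)
qed

lemma potential_x_bound:
  assumes "0 < (x::real)"
  shows "\<bar>x * (2 * x / (x\<^sup>2 + y\<^sup>2 + 1) - 1 / x)\<bar> \<le> 1"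
proof -
  have eq: "x * (2 * x / (x\<^sup>2 + y\<^sup>2 + 1) - 1 / x) = 2 * x\<^sup>2 / (x\<^sup>2 + y\<^sup>2 + 1) - 1"
    using assms by (simp add: right_diff_distrib power2_eq_square)
  have "0 \<le> 2 * x\<^sup>2 / (x\<^sup>2 + y\<^sup>2 + 1)"
    by (meson divide_nonneg_pos sum_squares_plus_one_pos zero_le_power2 mult_nonneg_nonneg zero_le_numeral)
  moreover have "2 * x\<^sup>2 / (x\<^sup>2 + y\<^sup>2 + 1) \<le> 2"
    by (simp add: divide_le_eq)
  ultimately show ?thesis unfolding eq by linarith
qed

text \<open>With \<open>z = 2 * x\<^sup>2 / (x\<^sup>2 + y\<^sup>2 + 1)\<close>, which is at most 2,
  the expression is \<open>z - z\<^sup>2 + 1\<close>. An upper bound suffices because it is later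
  multiplied by nonnegative factors only.\<close>

lemma potential_xx_bound:
  assumes "0 < (x::real)"
  shows "x\<^sup>2 * (2 / (x\<^sup>2 + y\<^sup>2 + 1) - 4 * x\<^sup>2 / (x\<^sup>2 + y\<^sup>2 + 1)\<^sup>2 + 1 / x\<^sup>2) \<le> 3"
proof -
  have eq: "x\<^sup>2 * (2 / (x\<^sup>2 + y\<^sup>2 + 1) - 4 * x\<^sup>2 / (x\<^sup>2 + y\<^sup>2 + 1)\<^sup>2 + 1 / x\<^sup>2)
     = 2 * x\<^sup>2 / (x\<^sup>2 + y\<^sup>2 + 1) - (2 * x\<^sup>2 / (x\<^sup>2 + y\<^sup>2 + 1))\<^sup>2 + 1"
    using assms by (simp add: algebra_simps power2_eq_square)
  have "2 * x\<^sup>2 / (x\<^sup>2 + y\<^sup>2 + 1) \<le> 2"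
    by (simp add: divide_le_eq)
  then show ?thesis unfolding eq
    using zero_le_power2[of "2 * x\<^sup>2 / (x\<^sup>2 + y\<^sup>2 + 1)"] by linarith
qed

lemma potential_y_bound: "\<bar>2 * x * y / (x\<^sup>2 + y\<^sup>2 + 1)\<bar> \<le> (1::real)"
proof -
  have "0 \<le> (x - y)\<^sup>2" "0 \<le> (x + y)\<^sup>2" by simp_all
  then have "\<bar>2 * x * y\<bar> \<le> x\<^sup>2 + y\<^sup>2 + 1"
    by (simp add: power2_diff power2_sum abs_le_iff)
  then show ?thesis
    using sum_squares_plus_one_pos[of x y] by (simp add: divide_le_eq del: sum_squares_plus_one_pos)
qed

text \<open>After division by the barrier every spatial term is at most a constant times
  \<open>v\<^sup>2\<close>, where \<open>v \<ge> 1\<close> is the base of the square in the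
  exponent. The time derivative contributes \<open>- \<beta> * v\<^sup>2\<close> and wins once
  \<open>\<beta>\<close> exceeds the sum of these constants.\<close>

lemma barrier_strict_supersolution:
  assumes x: "0 < x" and K: "0 < K" and th: "1 \<le> 1 + \<beta> * (t - \<tau>)" "1 + \<beta> * (t - \<tau>) \<le> 2"
    and A: "0 \<le> A" "A \<le> \<Lambda>" and c: "\<bar>c\<bar> \<le> B"
    and beta: "\<Lambda> * (20 * K\<^sup>2 + 12 * K) + 4 * B * K + 4 * K < \<beta>"
  shows "A * x\<^sup>2 * barrier_xx K \<beta> \<tau> (x, y, t) + c * x * barrier_x K \<beta> \<tau> (x, y, t)
           + barrier_Y K \<beta> \<tau> (x, y, t) < 0"
proof -
  define \<theta> v r where "\<theta> = 1 + \<beta> * (t - \<tau>)" and "v = K * potential x y + 1" and "r = x\<^sup>2 + y\<^sup>2 + 1"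
  define g1 g2 m where "g1 = 2 * x / r - 1 / x"
    and "g2 = 2 / r - 4 * x\<^sup>2 / r\<^sup>2 + 1 / x\<^sup>2" and "m = 2 * x * y / r"
  define p q where "p = x * g1" and "q = x\<^sup>2 * g2"
  have v: "1 \<le> v" using potential_pos[OF x, of y] K by (simp add: v_def)
  have b: "\<bar>p\<bar> \<le> 1" "q \<le> 3" "\<bar>m\<bar> \<le> 1"
    unfolding p_def q_def m_def r_def g1_def g2_def
    by (rule potential_x_bound[OF x] potential_xx_bound[OF x] potential_y_bound)+
  have p2: "p\<^sup>2 \<le> 1" using b(1) abs_square_le_1 by blast
  have vv: "1 \<le> v\<^sup>2" "v \<le> v\<^sup>2" "0 \<le> v"
    using v self_le_power[of v 2] one_le_power[of v 2] by auto
  have th: "1 \<le> \<theta>" "\<theta> \<le> 2" using th by (auto simp: \<theta>_def)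
  have tv: "\<theta> * v * K \<le> 2 * v\<^sup>2 * K"
    using th vv K by (intro mult_mono) auto
  have tv0: "0 \<le> \<theta> * v * K" using th vv K by auto
  \<comment> \<open>The bounds \<open>\<theta> \<le> 2\<close>, \<open>p\<^sup>2 \<le> 1\<close>,
    \<open>q \<le> 3\<close> and \<open>\<bar>m\<bar> \<le> 1\<close>, with 1 and \<open>v\<close>
    replaced by \<open>v\<^sup>2\<close>, give the constants: 16 + 4 = 20 for
    \<open>K\<^sup>2\<close>, then 12 for \<open>K\<close>, 4 for \<open>B * K\<close>, and 4 for
    the drift in \<open>y\<close>.\<close>
  have e1: "(2 * \<theta> * v * K * p)\<^sup>2 \<le> 16 * K\<^sup>2 * v\<^sup>2"
  proof -
    have "\<theta>\<^sup>2 \<le> 2\<^sup>2" using th by (intro power_mono) auto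
    then have "\<theta>\<^sup>2 * p\<^sup>2 \<le> 4 * 1" using p2 by (intro mult_mono) auto
    then have "4 * K\<^sup>2 * v\<^sup>2 * (\<theta>\<^sup>2 * p\<^sup>2) \<le> 4 * K\<^sup>2 * v\<^sup>2 * (4 * 1)" by (intro mult_left_mono) auto
    then show ?thesis by (simp add: power_mult_distrib algebra_simps)
  qed
  have e2: "2 * \<theta> * K\<^sup>2 * p\<^sup>2 \<le> 4 * K\<^sup>2 * v\<^sup>2"
  proof -
    have "\<theta> * p\<^sup>2 \<le> 2 * v\<^sup>2" using p2 th vv by (intro mult_mono) auto
    then have "2 * K\<^sup>2 * (\<theta> * p\<^sup>2) \<le> 2 * K\<^sup>2 * (2 * v\<^sup>2)" by (intro mult_left_mono) auto
    then show ?thesis by (simp add: algebra_simps)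
  qed
  have e3: "2 * \<theta> * v * K * q \<le> 12 * K * v\<^sup>2"
  proof -
    have "(\<theta> * v * K) * q \<le> (\<theta> * v * K) * 3" using b tv0 by (intro mult_left_mono) auto
    then show ?thesis using tv by (simp add: algebra_simps)
  qed
  have e4: "c * (2 * \<theta> * v * K * p) \<le> 4 * B * K * v\<^sup>2"
  proof -
    have "\<bar>c * p\<bar> \<le> B * 1"
      unfolding abs_mult using b c by (intro mult_mono) auto
    then have "(\<theta> * v * K) * (c * p) \<le> (\<theta> * v * K) * B" using tv0 by (intro mult_left_mono) auto
    also have "\<dots> \<le> (2 * v\<^sup>2 * K) * B" using c by (intro mult_right_mono[OF tv]) linarith
    finally show ?thesis by (simp add: algebra_simps)
  qed
  have e5: "2 * \<theta> * v * K * m \<le> 4 * K * v\<^sup>2"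
  proof -
    have "(\<theta> * v * K) * m \<le> (\<theta> * v * K) * 1" using b tv0 by (intro mult_left_mono) auto
    then show ?thesis using tv by (simp add: algebra_simps)
  qed
  have s1: "A * ((2 * \<theta> * v * K * p)\<^sup>2 + 2 * \<theta> * K\<^sup>2 * p\<^sup>2 + 2 * \<theta> * v * K * q)
      \<le> \<Lambda> * ((20 * K\<^sup>2 + 12 * K) * v\<^sup>2)"
  proof -
    have "(2 * \<theta> * v * K * p)\<^sup>2 + 2 * \<theta> * K\<^sup>2 * p\<^sup>2 + 2 * \<theta> * v * K * q \<le> (20 * K\<^sup>2 + 12 * K) * v\<^sup>2"
      using e1 e2 e3 by (simp add: algebra_simps)
    then have "A * ((2 * \<theta> * v * K * p)\<^sup>2 + 2 * \<theta> * K\<^sup>2 * p\<^sup>2 + 2 * \<theta> * v * K * q)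
       \<le> A * ((20 * K\<^sup>2 + 12 * K) * v\<^sup>2)" using A by (intro mult_left_mono)
    also have "\<dots> \<le> \<Lambda> * ((20 * K\<^sup>2 + 12 * K) * v\<^sup>2)" using A K by (intro mult_right_mono) auto
    finally show ?thesis .
  qed
  have "(\<Lambda> * (20 * K\<^sup>2 + 12 * K) + 4 * B * K + 4 * K) * v\<^sup>2 < \<beta> * v\<^sup>2"
    using beta vv by (intro mult_strict_right_mono) auto
  then have neg: "A * ((2 * \<theta> * v * K * p)\<^sup>2 + 2 * \<theta> * K\<^sup>2 * p\<^sup>2 + 2 * \<theta> * v * K * q)
      + c * (2 * \<theta> * v * K * p) + (2 * \<theta> * v * K * m - \<beta> * v\<^sup>2) < 0"
    using s1 e4 e5 by (simp add: algebra_simps)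
  have "A * x\<^sup>2 * barrier_xx K \<beta> \<tau> (x, y, t) + c * x * barrier_x K \<beta> \<tau> (x, y, t)
           + barrier_Y K \<beta> \<tau> (x, y, t)
     = barrier K \<beta> \<tau> (x, y, t) *
       (A * ((2 * \<theta> * v * K * p)\<^sup>2 + 2 * \<theta> * K\<^sup>2 * p\<^sup>2 + 2 * \<theta> * v * K * q)
      + c * (2 * \<theta> * v * K * p) + (2 * \<theta> * v * K * m - \<beta> * v\<^sup>2))"
    unfolding barrier_xx_def barrier_x_def barrier_Y_def prod.case
      \<theta>_def[symmetric] v_def[symmetric] r_def[symmetric] g1_def[symmetric]
      g2_def[symmetric] m_def[symmetric] p_def q_def
    by (simp add: algebra_simps power2_eq_square)
  also have "\<dots> < 0"
    using neg by (intro mult_pos_neg) (auto simp: barrier_def)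
  finally show ?thesis .
qed

section \<open>The maximum principle\<close>

text \<open>A positive \<open>h2\<close> would make \<open>h'\<close> positive immediately to the
  right of its zero \<open>x\<close>, so \<open>h\<close> would increase there. Continuity of the
  second derivative does not enter.\<close>

lemma second_derivative_at_max:
  fixes h h' :: "real \<Rightarrow> real"
  assumes d: "0 < d" and D1: "\<And>s. \<bar>s - x\<bar> < d \<Longrightarrow> (h has_real_derivative h' s) (at s)"
    and D2: "(h' has_real_derivative h2) (at x)"
    and max: "\<And>s. \<bar>s - x\<bar> < d \<Longrightarrow> h s \<le> h x"
  shows "h' x = 0" "h2 \<le> 0"
proof -
  show 0: "h' x = 0"
    using DERIV_local_max[OF D1 d] max d by (simp add: abs_minus_commute)
  show "h2 \<le> 0"
  proof (rule ccontr)
    assume "\<not> h2 \<le> 0"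
    then obtain e where e: "0 < e" "\<And>k. 0 < k \<Longrightarrow> k < e \<Longrightarrow> 0 < h' (x + k)"
      using DERIV_pos_inc_right[OF D2] 0 by auto
    define k where "k = min d e / 2"
    have k: "0 < k" "k < d" "k < e"
      using d e by (auto simp: k_def)
    have "h x < h (x + k)"
    proof (rule DERIV_pos_imp_increasing_open[where f = h])
      show "\<exists>y. DERIV h s :> y \<and> 0 < y" if "x < s" "s < x + k" for s
        using that k e(2)[of "s - x"] D1[of s] by auto
      show "continuous_on {x..x + k} h"
        using k by (intro continuous_at_imp_continuous_on ballI DERIV_isCont[OF D1]) auto
    qed (use k in auto)
    then show False
      using max[of "x + k"] k by simp
  qed
qed

lemma continuous_on_barrier: "continuous_on (strip t0 T) (barrier K \<beta> \<tau>)"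
proof -
  have "continuous_on (strip t0 T) (\<lambda>p. exp ((1 + \<beta> * (snd (snd p) - \<tau>)) *
      (K * (ln ((fst p)\<^sup>2 + (fst (snd p))\<^sup>2 + 1) - ln (fst p)) + 1)\<^sup>2))"
    by (intro continuous_intros) (auto simp: strip_def)
  then show ?thesis
    by (simp add: barrier_def potential_def case_prod_beta)
qed

text \<open>The hypothesis says \<open>r \<le> exp R * x\<close> with
  \<open>r = x\<^sup>2 + y\<^sup>2 + 1\<close>; the three bounds follow from
  \<open>1 \<le> r\<close>, \<open>x\<^sup>2 \<le> r\<close> and \<open>y\<^sup>2 \<le> r\<close>.
  Sublevels thus stay away from \<open>x = 0\<close> as well as from infinity.\<close>

lemma bounded_potential_sublevel:
  assumes "0 < x" "potential x y \<le> R"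
  shows "exp (- R) \<le> x" "x \<le> exp R" "\<bar>y\<bar> \<le> exp R"
proof -
  define r where "r = x\<^sup>2 + y\<^sup>2 + 1"
  have r: "0 < r" "1 \<le> r" "x\<^sup>2 \<le> r" "y\<^sup>2 \<le> r" by (auto simp: r_def)
  have "ln r \<le> R + ln x" using assms by (simp add: potential_def r_def)
  then have "exp (ln r) \<le> exp (R + ln x)" by (simp only: exp_le_cancel_iff)
  then have rx: "r \<le> exp R * x" using assms r by (simp add: exp_add)
  show "exp (- R) \<le> x" using rx r by (simp add: exp_minus field_simps)
  have "x * x \<le> exp R * x" using rx r by (simp add: power2_eq_square)
  then show x: "x \<le> exp R" using assms by simp
  have "y\<^sup>2 \<le> exp R * x" using rx r by simp
  also have "\<dots> \<le> (exp R)\<^sup>2" using x by (simp add: power2_eq_square)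
  finally show "\<bar>y\<bar> \<le> exp R" by (simp add: abs_le_square_iff[symmetric])
qed

lemma tendsto_Y_quot_strip:
  assumes "0 < x" "((\<lambda>s. f (x, y + s * x, t - s)) has_real_derivative l) (at 0)"
  shows "(Y_quot f (x, y, t) \<longlongrightarrow> l) (Y_filter (strip t0 T) (x, y, t))"
proof -
  have "((\<lambda>s. f (x, y + s * x, t - s)) has_real_derivative l) (at 0 within {t - T..<t - t0})"
    using assms(2) by (rule has_field_derivative_at_within)
  then show ?thesis
    using assms(1) by (simp add: has_field_derivative_iff Y_filter_strip Y_quot_def)
qed

section \<open>Comparison with the barrier on one slab, then on the whole strip\<close>

lemma max_principle_slab:
  fixes w wx wxx wY A c :: "real \<times> real \<times> real \<Rightarrow> real"
  assumes cont: "continuous_on (strip t0 T) w"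
    and D1: "\<And>x y t. (x, y, t) \<in> strip t0 T \<Longrightarrow>
        ((\<lambda>s. w (s, y, t)) has_real_derivative wx (x, y, t)) (at x)"
    and D2: "\<And>x y t. (x, y, t) \<in> strip t0 T \<Longrightarrow>
        ((\<lambda>s. wx (s, y, t)) has_real_derivative wxx (x, y, t)) (at x)"
    and DY: "\<And>p. p \<in> strip t0 T \<Longrightarrow> (Y_quot w p \<longlongrightarrow> wY p) (Y_filter (strip t0 T) p)"
    and sub: "\<And>p. p \<in> strip t0 T \<Longrightarrow> 0 \<le> A p * (fst p)\<^sup>2 * wxx p + c p * fst p * wx p + wY p"
    and A: "\<And>p. p \<in> strip t0 T \<Longrightarrow> 0 \<le> A p \<and> A p \<le> \<Lambda>"
    and c: "\<And>p. p \<in> strip t0 T \<Longrightarrow> \<bar>c p\<bar> \<le> B"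
    and init: "\<And>x y. 0 < x \<Longrightarrow> (w \<longlongrightarrow> 0) (at (x, y, t0) within strip t0 T)"
    and growth: "\<And>x y t. (x, y, t) \<in> strip t0 T \<Longrightarrow> w (x, y, t) \<le> M * exp ((C * potential x y + 1)\<^sup>2)"
    and C: "0 < C" "0 < M"
    and beta: "\<Lambda> * (20 * (2 * C)\<^sup>2 + 12 * (2 * C)) + 4 * B * (2 * C) + 4 * (2 * C) < \<beta>" "0 < \<beta>"
    and before: "\<And>x y t. (x, y, t) \<in> strip t0 T \<Longrightarrow> t \<le> \<tau> \<Longrightarrow> w (x, y, t) \<le> 0"
    and xyt: "(x, y, t) \<in> strip t0 T" "t \<le> \<tau> + 1 / \<beta>"
  shows "w (x, y, t) \<le> 0"
proof -
  \<comment> \<open>Doubling \<open>C\<close> makes the barrier outgrow the bound on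
    \<open>w\<close> as the potential tends to infinity.\<close>
  define H where "H = barrier (2 * C) \<beta> \<tau>"
  have Hpos: "0 < H p" for p by (cases p) (simp add: H_def barrier_def)
  have le_scaled: "w (x, y, t) \<le> \<epsilon> * H (x, y, t)" if \<epsilon>: "0 < \<epsilon>" for \<epsilon>
  proof (rule ccontr)
    assume neg: "\<not> w (x, y, t) \<le> \<epsilon> * H (x, y, t)"
    define f where "f = (\<lambda>p. w p - \<epsilon> * H p)"
    define P where "P = {p \<in> strip t0 T. snd (snd p) \<le> \<tau> + 1 / \<beta> \<and> 0 \<le> f p}"
    have contf: "continuous_on (strip t0 T) f"
      unfolding f_def H_def by (intro continuous_intros cont continuous_on_barrier)
    \<comment> \<open>On \<open>P\<close> the function \<open>w\<close> is at least
      \<open>\<epsilon> * H > 0\<close>, so \<open>before\<close> excludes times up to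
      \<open>\<tau>\<close>; the time coefficient then lies between 1 and 2, as the supersolution
      estimate requires.\<close>
    have later: "\<tau> < t'" "1 \<le> 1 + \<beta> * (t' - \<tau>)" "1 + \<beta> * (t' - \<tau>) \<le> 2" if "(x', y', t') \<in> P" for x' y' t'
    proof -
      have "0 < \<epsilon> * H (x', y', t')" using \<epsilon> Hpos by simp
      then show 1: "\<tau> < t'" using that before[of x' y' t'] by (force simp: P_def f_def)
      then show "1 \<le> 1 + \<beta> * (t' - \<tau>)" using beta by simp
      have "\<beta> * (t' - \<tau>) \<le> \<beta> * (1 / \<beta>)" using that beta by (intro mult_left_mono) (auto simp: P_def)
      then show "1 + \<beta> * (t' - \<tau>) \<le> 2" using beta by simp
    qed
    have H1: "1 \<le> H p" if "p \<in> P" for p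
      using later that by (cases p) (force simp: H_def barrier_def)
    \<comment> \<open>This uniform positive bound keeps \<open>P\<close> away from the initial time,
      where \<open>w\<close> tends to 0.\<close>
    have w1: "\<epsilon> \<le> w p" if "p \<in> P" for p
    proof -
      have "\<epsilon> * 1 \<le> \<epsilon> * H p" using H1[OF that] \<epsilon> by (intro mult_left_mono) auto
      then show ?thesis using that by (simp add: P_def f_def)
    qed
    \<comment> \<open>Comparing barrier and growth bound on \<open>P\<close> leaves
      \<open>\<epsilon> * exp (3 * (C * g)\<^sup>2 + 2 * C * g) \<le> M\<close>; bounding the
      exponential below by \<open>2 * C * g\<close> gives \<open>g \<le> R\<close>.\<close>
    define R where "R = M / (\<epsilon> * (2 * C))"
    have pot: "potential x' y' \<le> R" if "(x', y', t') \<in> P" for x' y' t'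
    proof -
      define g where "g = potential x' y'"
      have xp: "(x', y', t') \<in> strip t0 T" using that by (simp add: P_def)
      have g: "0 < g" using xp potential_pos by (simp add: g_def)
      have "exp ((2 * C * g + 1)\<^sup>2) \<le> H (x', y', t')"
      proof -
        have "1 * (2 * C * g + 1)\<^sup>2 \<le> (1 + \<beta> * (t' - \<tau>)) * (2 * C * g + 1)\<^sup>2"
          using later[OF that] by (intro mult_right_mono) auto
        then show ?thesis by (simp add: H_def barrier_def g_def)
      qed
      then have "\<epsilon> * exp ((2 * C * g + 1)\<^sup>2) \<le> \<epsilon> * H (x', y', t')" using \<epsilon> by simp
      also have "\<dots> \<le> w (x', y', t')" using that by (simp add: P_def f_def)
      also have "\<dots> \<le> M * exp ((C * g + 1)\<^sup>2)" using growth[OF xp] by (simp add: g_def)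
      finally have le: "\<epsilon> * exp ((2 * C * g + 1)\<^sup>2) \<le> M * exp ((C * g + 1)\<^sup>2)" .
      have "(2 * C * g + 1)\<^sup>2 = (3 * (C * g)\<^sup>2 + 2 * C * g) + (C * g + 1)\<^sup>2"
        by (simp add: power2_eq_square algebra_simps)
      with le have "(\<epsilon> * exp (3 * (C * g)\<^sup>2 + 2 * C * g)) * exp ((C * g + 1)\<^sup>2) \<le> M * exp ((C * g + 1)\<^sup>2)"
        by (simp add: exp_add mult.assoc)
      then have "\<epsilon> * exp (3 * (C * g)\<^sup>2 + 2 * C * g) \<le> M" by simp
      moreover have "2 * C * g \<le> exp (3 * (C * g)\<^sup>2 + 2 * C * g)"
        using exp_ge_add_one_self[of "3 * (C * g)\<^sup>2 + 2 * C * g"] zero_le_power2[of "C * g"] by linarith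
      ultimately have "\<epsilon> * (2 * C * g) \<le> M"
        using \<epsilon> by (meson mult_left_mono less_imp_le order_trans)
      then show ?thesis using \<epsilon> C by (simp add: R_def g_def field_simps)
    qed
    have Pbox: "P \<subseteq> cbox (exp (- R), - exp R, t0) (exp R, exp R, T)"
    proof
      fix p assume p: "p \<in> P"
      obtain x' y' t' where pe: "p = (x', y', t')" by (cases p)
      have xp: "0 < x'" "t0 < t'" "t' \<le> T" using p by (auto simp: P_def pe)
      show "p \<in> cbox (exp (- R), - exp R, t0) (exp R, exp R, T)"
        using bounded_potential_sublevel[OF xp(1) pot[OF p[unfolded pe]]] xp
        by (auto simp: pe cbox_Pair_eq)
    qed
    \<comment> \<open>The box keeps limits away from \<open>x = 0\<close> but contains
      \<open>t = t0\<close>; a limit there is excluded because \<open>w\<close> would tend to 0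
      while staying at least \<open>\<epsilon>\<close>.\<close>
    have "closed P"
      unfolding closed_sequential_limits
    proof (intro allI impI, elim conjE)
      fix z l assume z: "\<forall>n. z n \<in> P" and lim: "z \<longlonglongrightarrow> l"
      obtain x' y' t' where le: "l = (x', y', t')" by (cases l)
      have "l \<in> cbox (exp (- R), - exp R, t0) (exp R, exp R, T)"
        using Pbox z by (intro closed_sequentially[OF closed_cbox _ lim]) auto
      then have x': "0 < x'" "t0 \<le> t'" "t' \<le> T"
        using less_le_trans[OF exp_gt_zero[of "- R"]] by (auto simp: le cbox_Pair_eq)
      have zs: "z n \<in> strip t0 T" for n using z by (auto simp: P_def)
      have ne: "t' \<noteq> t0"
      proof
        assume t': "t' = t0"
        have "filterlim z (at (x', y', t0) within strip t0 T) sequentially"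
        proof -
          have "z n \<noteq> (x', y', t0)" for n
            using zs[of n] by auto
          then show ?thesis
            using lim zs unfolding filterlim_at le t' by simp
        qed
        then have "(\<lambda>n. w (z n)) \<longlonglongrightarrow> 0"
          by (rule filterlim_compose[OF init[OF x'(1)]])
        moreover have "\<epsilon> \<le> w (z n)" for n using w1 z by blast
        ultimately have "\<epsilon> \<le> 0" by (intro LIMSEQ_le_const) auto
        then show False using \<epsilon> by simp
      qed
      then have ls: "l \<in> strip t0 T" using x' by (auto simp: le)
      have "(\<lambda>n. f (z n)) \<longlonglongrightarrow> f l"
        using continuous_on_tendsto_compose[OF contf lim ls] zs by simp
      then have "0 \<le> f l" using z by (intro LIMSEQ_le_const) (auto simp: P_def)
      moreover have "snd (snd l) \<le> \<tau> + 1 / \<beta>"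
        using z by (intro LIMSEQ_le_const2[OF tendsto_snd[OF tendsto_snd[OF lim]]]) (auto simp: P_def)
      ultimately show "l \<in> P" using ls by (simp add: P_def)
    qed
    moreover have "bounded P" using Pbox bounded_cbox bounded_subset by blast
    ultimately have "compact P" by (simp add: compact_eq_bounded_closed)
    moreover have P0: "(x, y, t) \<in> P" using xyt neg by (simp add: P_def f_def)
    moreover have "continuous_on P f" using contf by (rule continuous_on_subset) (auto simp: P_def)
    ultimately obtain p where p: "p \<in> P" "\<And>q. q \<in> P \<Longrightarrow> f q \<le> f p"
      using continuous_attains_sup[of P f] by blast
    obtain x1 y1 t1 where pe: "p = (x1, y1, t1)" by (cases p)
    have ps: "(x1, y1, t1) \<in> strip t0 T" "t1 \<le> \<tau> + 1 / \<beta>" using p by (auto simp: P_def pe)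
    \<comment> \<open>Outside \<open>P\<close> the function \<open>f\<close> is negative, so its
      maximum over \<open>P\<close> is a maximum over the whole slab.\<close>
    have max: "f q \<le> f (x1, y1, t1)" if "q \<in> strip t0 T" "snd (snd q) \<le> \<tau> + 1 / \<beta>" for q
    proof (cases "q \<in> P")
      case False
      then have "f q < 0" using that by (auto simp: P_def)
      also have "0 \<le> f p" using p by (simp add: P_def)
      finally show ?thesis by (simp add: pe)
    qed (use p pe in auto)
    have x1: "0 < x1" "t0 < t1" "t1 \<le> T" using ps by auto
    have near: "(s, y1, t1) \<in> strip t0 T" if "\<bar>s - x1\<bar> < x1" for s
      using that x1 by auto
    have d1: "((\<lambda>s. f (s, y1, t1)) has_real_derivative
        wx (s, y1, t1) - \<epsilon> * barrier_x (2 * C) \<beta> \<tau> (s, y1, t1)) (at s)" if "\<bar>s - x1\<bar> < x1" for s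
      unfolding f_def H_def using near[OF that]
      by (intro derivative_intros D1 DERIV_cmult has_derivative_barrier_x) auto
    have d2: "((\<lambda>s. wx (s, y1, t1) - \<epsilon> * barrier_x (2 * C) \<beta> \<tau> (s, y1, t1)) has_real_derivative
        wxx (x1, y1, t1) - \<epsilon> * barrier_xx (2 * C) \<beta> \<tau> (x1, y1, t1)) (at x1)"
      using ps by (intro derivative_intros D2 DERIV_cmult has_derivative_barrier_xx) auto
    have fx: "wx (x1, y1, t1) - \<epsilon> * barrier_x (2 * C) \<beta> \<tau> (x1, y1, t1) = 0"
      and fxx: "wxx (x1, y1, t1) - \<epsilon> * barrier_xx (2 * C) \<beta> \<tau> (x1, y1, t1) \<le> 0"
      using second_derivative_at_max[OF x1(1) d1 d2] max near ps by auto
    have "(Y_quot f (x1, y1, t1) \<longlongrightarrow> wY (x1, y1, t1) - \<epsilon> * barrier_Y (2 * C) \<beta> \<tau> (x1, y1, t1))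
       (Y_filter (strip t0 T) (x1, y1, t1))"
    proof -
      have "((\<lambda>s. Y_quot w (x1, y1, t1) s - \<epsilon> * Y_quot H (x1, y1, t1) s) \<longlongrightarrow>
          wY (x1, y1, t1) - \<epsilon> * barrier_Y (2 * C) \<beta> \<tau> (x1, y1, t1)) (Y_filter (strip t0 T) (x1, y1, t1))"
        unfolding H_def
        by (intro tendsto_intros DY ps tendsto_Y_quot_strip has_derivative_barrier_Y x1)
      moreover have "Y_quot f (x1, y1, t1) = (\<lambda>s. Y_quot w (x1, y1, t1) s - \<epsilon> * Y_quot H (x1, y1, t1) s)"
        by (simp add: Y_quot_def f_def fun_eq_iff diff_divide_distrib right_diff_distrib)
      ultimately show ?thesis by simp
    qed
    \<comment> \<open>The maximum may lie at the final time of the slab, so only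
      \<open>s > 0\<close>, that is earlier times, can be compared. The quotients are then
      nonpositive, and so is their limit.\<close>
    then have "(Y_quot f (x1, y1, t1) \<longlongrightarrow> wY (x1, y1, t1) - \<epsilon> * barrier_Y (2 * C) \<beta> \<tau> (x1, y1, t1))
       (at 0 within {0<..<t1 - t0})"
      using x1 by (auto simp: Y_filter_strip elim: tendsto_within_subset)
    moreover have "at 0 within {0<..<t1 - t0} \<noteq> bot"
      using x1 by (simp add: trivial_limit_within islimpt_greaterThanLessThan1)
    moreover have "\<forall>\<^sub>F s in at 0 within {0<..<t1 - t0}. Y_quot f (x1, y1, t1) s \<le> 0"
      unfolding eventually_at_filter
    proof (intro always_eventually allI impI)
      fix s assume s: "s \<in> {0<..<t1 - t0}"
      have "f (x1, y1 + s * x1, t1 - s) \<le> f (x1, y1, t1)"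
        using s ps by (intro max) auto
      then show "Y_quot f (x1, y1, t1) s \<le> 0"
        using s by (simp add: Y_quot_def divide_nonpos_pos)
    qed
    ultimately have fY: "wY (x1, y1, t1) - \<epsilon> * barrier_Y (2 * C) \<beta> \<tau> (x1, y1, t1) \<le> 0"
      using tendsto_upperbound by blast
    have strict: "A p * x1\<^sup>2 * barrier_xx (2 * C) \<beta> \<tau> p + c p * x1 * barrier_x (2 * C) \<beta> \<tau> p
           + barrier_Y (2 * C) \<beta> \<tau> p < 0"
    proof -
      have "0 \<le> A p" "A p \<le> \<Lambda>" "\<bar>c p\<bar> \<le> B" using A c ps by (auto simp: pe)
      moreover have "0 < 2 * C" using C by simp
      ultimately show ?thesis
        unfolding pe
        by (intro barrier_strict_supersolution[OF x1(1) _ later(2,3)[OF p(1)[unfolded pe]] _ _ _ beta(1)])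
    qed
    \<comment> \<open>By linearity the operator on \<open>w\<close> is that on \<open>f\<close> plus
      \<open>\<epsilon>\<close> times that on \<open>H\<close>. At the maximum the first is
      nonpositive and the second negative, against \<open>sub\<close>.\<close>
    have "A p * x1\<^sup>2 * wxx p + c p * x1 * wx p + wY p
      = A p * x1\<^sup>2 * (wxx p - \<epsilon> * barrier_xx (2 * C) \<beta> \<tau> p) + c p * x1 * (wx p - \<epsilon> * barrier_x (2 * C) \<beta> \<tau> p)
        + (wY p - \<epsilon> * barrier_Y (2 * C) \<beta> \<tau> p)
        + \<epsilon> * (A p * x1\<^sup>2 * barrier_xx (2 * C) \<beta> \<tau> p + c p * x1 * barrier_x (2 * C) \<beta> \<tau> p
           + barrier_Y (2 * C) \<beta> \<tau> p)"
      by (simp add: algebra_simps)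
    moreover have "A p * x1\<^sup>2 * (wxx p - \<epsilon> * barrier_xx (2 * C) \<beta> \<tau> p) \<le> 0"
      using A[of p] ps fxx by (intro mult_nonneg_nonpos) (auto simp: pe)
    moreover have "\<epsilon> * (A p * x1\<^sup>2 * barrier_xx (2 * C) \<beta> \<tau> p + c p * x1 * barrier_x (2 * C) \<beta> \<tau> p
           + barrier_Y (2 * C) \<beta> \<tau> p) < 0"
      using \<epsilon> strict by (rule mult_pos_neg)
    moreover have "0 \<le> A p * x1\<^sup>2 * wxx p + c p * x1 * wx p + wY p"
      using sub[of p] ps by (simp add: pe)
    ultimately show False
      using fx fY by (simp add: pe)
  qed
  have "w (x, y, t) \<le> 0 + e" if "0 < e" for e
  proof -
    have "w (x, y, t) \<le> e / H (x, y, t) * H (x, y, t)"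
      using that Hpos by (intro le_scaled) simp
    then show ?thesis
      using Hpos[of "(x, y, t)"] by simp
  qed
  then show ?thesis by (rule field_le_epsilon)
qed

lemma max_principle_strip:
  fixes w wx wxx wY A c :: "real \<times> real \<times> real \<Rightarrow> real"
  assumes cont: "continuous_on (strip t0 T) w"
    and D1: "\<And>x y t. (x, y, t) \<in> strip t0 T \<Longrightarrow>
        ((\<lambda>s. w (s, y, t)) has_real_derivative wx (x, y, t)) (at x)"
    and D2: "\<And>x y t. (x, y, t) \<in> strip t0 T \<Longrightarrow>
        ((\<lambda>s. wx (s, y, t)) has_real_derivative wxx (x, y, t)) (at x)"
    and DY: "\<And>p. p \<in> strip t0 T \<Longrightarrow> (Y_quot w p \<longlongrightarrow> wY p) (Y_filter (strip t0 T) p)"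
    and sub: "\<And>p. p \<in> strip t0 T \<Longrightarrow> 0 \<le> A p * (fst p)\<^sup>2 * wxx p + c p * fst p * wx p + wY p"
    and A: "\<And>p. p \<in> strip t0 T \<Longrightarrow> 0 \<le> A p \<and> A p \<le> \<Lambda>"
    and c: "\<And>p. p \<in> strip t0 T \<Longrightarrow> \<bar>c p\<bar> \<le> B"
    and init: "\<And>x y. 0 < x \<Longrightarrow> (w \<longlongrightarrow> 0) (at (x, y, t0) within strip t0 T)"
    and growth: "\<And>x y t. (x, y, t) \<in> strip t0 T \<Longrightarrow> w (x, y, t) \<le> M * exp ((C * potential x y + 1)\<^sup>2)"
    and C: "0 < C" "0 < M"
    and p: "p \<in> strip t0 T"
  shows "w p \<le> 0"
proof -
  \<comment> \<open>This \<open>\<beta>\<close> depends only on \<open>\<Lambda>\<close>,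
    \<open>B\<close> and \<open>C\<close>, not on the starting time, so the slabs have equal length
    \<open>1 / \<beta>\<close> and finitely many reach any given time.\<close>
  define \<beta> where "\<beta> = \<bar>\<Lambda> * (20 * (2 * C)\<^sup>2 + 12 * (2 * C)) + 4 * B * (2 * C) + 4 * (2 * C)\<bar> + 1"
  have beta: "\<Lambda> * (20 * (2 * C)\<^sup>2 + 12 * (2 * C)) + 4 * B * (2 * C) + 4 * (2 * C) < \<beta>" "0 < \<beta>"
    unfolding \<beta>_def by linarith+
  \<comment> \<open>The case \<open>n = 0\<close> is vacuous, since points of the strip have
    \<open>t > t0\<close>.\<close>
  have *: "\<forall>x y t. (x, y, t) \<in> strip t0 T \<longrightarrow> t \<le> t0 + real n / \<beta> \<longrightarrow> w (x, y, t) \<le> 0" for n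
  proof (induction n)
    case (Suc n)
    show ?case
    proof (intro allI impI)
      fix x y t assume xyt: "(x, y, t) \<in> strip t0 T" "t \<le> t0 + real (Suc n) / \<beta>"
      show "w (x, y, t) \<le> 0"
      proof (rule max_principle_slab[where w = w and wx = wx and wxx = wxx and wY = wY and A = A
            and c = c and \<tau> = "t0 + real n / \<beta>" and \<beta> = \<beta>])
        show "w (x', y', t') \<le> 0" if "(x', y', t') \<in> strip t0 T" "t' \<le> t0 + real n / \<beta>" for x' y' t'
          using Suc.IH that by blast
        show "t \<le> t0 + real n / \<beta> + 1 / \<beta>"
          using xyt(2) by (simp add: add_divide_distrib)
      qed (fact cont D1 D2 DY sub A c init growth C beta xyt)+
    qed
  qed auto
  obtain x y t where pe: "p = (x, y, t)" by (cases p)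
  obtain n where "\<beta> * (t - t0) \<le> real n" using real_arch_simple by blast
  then have "t \<le> t0 + real n / \<beta>" using beta by (simp add: field_simps)
  then show ?thesis using * p by (auto simp: pe)
qed

section \<open>Uniqueness for the Cauchy problem\<close>

lemma continuous_on_dx_if_fst_mult:
  assumes "continuous_on (strip t0 T) (\<lambda>p. fst p * dx u p)"
  shows "continuous_on (strip t0 T) (dx u)"
proof -
  have "continuous_on (strip t0 T) (\<lambda>p. fst p * dx u p / fst p)"
    by (intro continuous_intros assms) (auto simp: strip_def)
  then show ?thesis
    by (rule continuous_on_eq) (auto simp: strip_def)
qed

text \<open>By the product rule the divergence term splits off the first-order coefficient
  \<open>\<partial>_x (x a)\<close>. Together with \<open>b\<close> it is the bounded drift that the
  maximum principle expects.\<close>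

lemma classical_solution_nondivergence:
  assumes sol: "classical_solution a b (strip t0 T) u" and a: "dx_exists_on pos_space a"
    and p: "p \<in> strip t0 T"
  shows "a p * (fst p)\<^sup>2 * dx (dx u) p + (dx (\<lambda>q. fst q * a q) p + b p) * fst p * dx u p
           + lieY (strip t0 T) u p = 0"
proof -
  obtain x y t where pe: "p = (x, y, t)" by (cases p)
  have ps: "(x, y, t) \<in> strip t0 T" "(x, y, t) \<in> pos_space" using p by (auto simp: pe pos_space_def)
  note Da = has_real_derivative_dx[OF a ps(2)]
  have Du: "((\<lambda>s. dx u (s, y, t)) has_real_derivative dx (dx u) (x, y, t)) (at x)"
    using sol ps(1) by (intro has_real_derivative_dx) (auto simp: classical_solution_def)
  have "((\<lambda>s. s * a (s, y, t)) has_real_derivative (a (x, y, t) + x * dx a (x, y, t))) (at x)"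
    by (rule derivative_eq_intros Da refl)+ simp
  then have 1: "dx (\<lambda>q. fst q * a q) p = a p + x * dx a p"
    by (simp add: dx_def pe DERIV_imp_deriv)
  have "((\<lambda>s. a (s, y, t) * s * dx u (s, y, t)) has_real_derivative
      (a p + x * dx a p) * dx u p + a p * x * dx (dx u) p) (at x)"
    by (rule derivative_eq_intros Da Du refl)+ (simp add: pe algebra_simps)
  then have 2: "dx (\<lambda>q. a q * fst q * dx u q) p = (a p + x * dx a p) * dx u p + a p * x * dx (dx u) p"
    by (subst dx_def) (simp add: pe DERIV_imp_deriv)
  have "Lop a b (strip t0 T) u p = 0"
    using sol p by (simp add: classical_solution_def)
  then show ?thesis
    unfolding Lop_def 1 2 by (simp add: pe algebra_simps power2_eq_square)
qed

text \<open>The difference of the solutions satisfies the same linear equation with initial limit 0.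
  The drift bound is \<open>2 * \<Lambda>\<close>, one \<open>\<Lambda>\<close> for each summand of
  the first-order coefficient.\<close>

lemma cauchy_solution_le:
  fixes a b u1 u2 :: "real \<times> real \<times> real \<Rightarrow> real"
  assumes a: "dx_exists_on pos_space a" "\<And>p. p \<in> pos_space \<Longrightarrow> 0 \<le> a p \<and> a p \<le> \<Lambda>"
    and b: "\<And>p. p \<in> pos_space \<Longrightarrow> \<bar>b p\<bar> \<le> \<Lambda>"
    and xa: "\<And>p. p \<in> pos_space \<Longrightarrow> \<bar>dx (\<lambda>q. fst q * a q) p\<bar> \<le> \<Lambda>"
    and sol: "cauchy_solution a b t0 T \<phi> u1" "cauchy_solution a b t0 T \<phi> u2"
    and C: "0 < C" "0 < M"
    and growth: "\<And>x y t. (x, y, t) \<in> strip t0 T \<Longrightarrow>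
           u1 (x, y, t) - u2 (x, y, t) \<le> M * exp ((C * potential x y + 1)\<^sup>2)"
    and p: "p \<in> strip t0 T"
  shows "u1 p \<le> u2 p"
proof -
  have sub: "q \<in> strip t0 T \<Longrightarrow> q \<in> pos_space" for q by (auto simp: strip_def pos_space_def)
  have cl: "classical_solution a b (strip t0 T) u1" "classical_solution a b (strip t0 T) u2"
    using sol by (auto simp: cauchy_solution_def)
  have cont: "continuous_on (strip t0 T) u1" "continuous_on (strip t0 T) u2"
    using cl by (auto simp: classical_solution_def intro!: continuous_on_strip_if_dx_lieY
        continuous_on_dx_if_fst_mult)
  have ex: "dx_exists_on (strip t0 T) u1" "dx_exists_on (strip t0 T) u2"
      "dx_exists_on (strip t0 T) (dx u1)" "dx_exists_on (strip t0 T) (dx u2)"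
      "lieY_exists_on (strip t0 T) u1" "lieY_exists_on (strip t0 T) u2"
    using cl by (auto simp: classical_solution_def)
  have "(\<lambda>q. u1 q - u2 q) p \<le> 0"
  proof (rule max_principle_strip[where A = a and \<Lambda> = \<Lambda> and B = "2 * \<Lambda>"
        and c = "\<lambda>q. dx (\<lambda>q. fst q * a q) q + b q" and C = C and M = M
        and wx = "\<lambda>q. dx u1 q - dx u2 q" and wxx = "\<lambda>q. dx (dx u1) q - dx (dx u2) q"
        and wY = "\<lambda>q. lieY (strip t0 T) u1 q - lieY (strip t0 T) u2 q"])
    show "continuous_on (strip t0 T) (\<lambda>q. u1 q - u2 q)"
      by (intro continuous_intros cont)
    show "((\<lambda>s. u1 (s, y, t) - u2 (s, y, t)) has_real_derivative dx u1 (x, y, t) - dx u2 (x, y, t)) (at x)"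
      if "(x, y, t) \<in> strip t0 T" for x y t
      by (rule DERIV_diff[OF has_real_derivative_dx[OF ex(1) that] has_real_derivative_dx[OF ex(2) that]])
    show "((\<lambda>s. dx u1 (s, y, t) - dx u2 (s, y, t)) has_real_derivative
        dx (dx u1) (x, y, t) - dx (dx u2) (x, y, t)) (at x)" if "(x, y, t) \<in> strip t0 T" for x y t
      by (rule DERIV_diff[OF has_real_derivative_dx[OF ex(3) that] has_real_derivative_dx[OF ex(4) that]])
    show "(Y_quot (\<lambda>q. u1 q - u2 q) q \<longlongrightarrow> lieY (strip t0 T) u1 q - lieY (strip t0 T) u2 q)
        (Y_filter (strip t0 T) q)" if "q \<in> strip t0 T" for q
    proof -
      have "Y_quot (\<lambda>q. u1 q - u2 q) q = (\<lambda>s. Y_quot u1 q s - Y_quot u2 q s)"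
        by (cases q) (auto simp: Y_quot_def fun_eq_iff diff_divide_distrib)
      then show ?thesis
        using tendsto_diff[OF tendsto_lieY[OF ex(5) that] tendsto_lieY[OF ex(6) that]] by simp
    qed
    show "0 \<le> a q * (fst q)\<^sup>2 * (dx (dx u1) q - dx (dx u2) q)
        + (dx (\<lambda>q. fst q * a q) q + b q) * fst q * (dx u1 q - dx u2 q)
        + (lieY (strip t0 T) u1 q - lieY (strip t0 T) u2 q)" if "q \<in> strip t0 T" for q
      using classical_solution_nondivergence[OF cl(1) a(1) that]
        classical_solution_nondivergence[OF cl(2) a(1) that] by (simp add: algebra_simps)
    show "\<bar>dx (\<lambda>q. fst q * a q) q + b q\<bar> \<le> 2 * \<Lambda>" if "q \<in> strip t0 T" for q
      using xa[OF sub[OF that]] b[OF sub[OF that]] by linarith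
    show "((\<lambda>q. u1 q - u2 q) \<longlongrightarrow> 0) (at (x, y, t0) within strip t0 T)" if "0 < x" for x y
    proof -
      have "(u1 \<longlongrightarrow> \<phi> (x, y)) (at (x, y, t0) within strip t0 T)"
        "(u2 \<longlongrightarrow> \<phi> (x, y)) (at (x, y, t0) within strip t0 T)"
        using sol that by (auto simp: cauchy_solution_def)
      from tendsto_diff[OF this] show ?thesis by simp
    qed
  qed (use a(2) sub growth C p in auto)
  then show ?thesis by simp
qed

theorem theorem1p5:
  fixes a b u1 u2 :: "real \<times> real \<times> real \<Rightarrow> real"
    and \<phi> :: "real \<times> real \<Rightarrow> real"
    and \<alpha> lam \<Lambda> t0 T M C :: real
  assumes "0 < \<alpha>" "\<alpha> \<le> 1"
    and "dx_exists_on pos_space a" "dx_exists_on pos_space b"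
    and "holder_loc \<alpha> pos_space a" "holder_loc \<alpha> pos_space b"
    and "holder_loc \<alpha> pos_space (dx a)" "holder_loc \<alpha> pos_space (dx b)"
    and "0 < lam" "0 < \<Lambda>"
    and "\<And>p. p \<in> pos_space \<Longrightarrow> lam \<le> a p \<and> a p \<le> \<Lambda>"
    and "\<And>p. p \<in> pos_space \<Longrightarrow> \<bar>b p\<bar> \<le> \<Lambda>"
    and "\<And>p. p \<in> pos_space \<Longrightarrow> \<bar>dx (\<lambda>q. fst q * a q) p\<bar> \<le> \<Lambda>"
    and "\<And>p. p \<in> pos_space \<Longrightarrow> \<bar>dx (\<lambda>q. fst q * b q) p\<bar> \<le> \<Lambda>"
    and "t0 < T"
    and "cauchy_solution a b t0 T \<phi> u1" "cauchy_solution a b t0 T \<phi> u2"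
    and "0 < M" "0 < C"
    and "\<And>x y t. (x, y, t) \<in> strip t0 T \<Longrightarrow>
           \<bar>u1 (x, y, t)\<bar> + \<bar>u2 (x, y, t)\<bar>
             \<le> M * exp ((C * (ln (x\<^sup>2 + y\<^sup>2 + 1) - ln x) + 1)\<^sup>2)"
  shows "\<forall>p\<in>strip t0 T. u1 p = u2 p"
proof (intro ballI order_antisym)
  fix p assume p: "p \<in> strip t0 T"
  have a: "0 \<le> a q \<and> a q \<le> \<Lambda>" if "q \<in> pos_space" for q
    using assms(9) assms(11)[OF that] by linarith
  \<comment> \<open>The bound on the sum of absolute values controls both signed differences, so the
    comparison applies with the solutions in either order.\<close>
  have "u1 (x, y, t) - u2 (x, y, t) \<le> M * exp ((C * potential x y + 1)\<^sup>2)"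
    and "u2 (x, y, t) - u1 (x, y, t) \<le> M * exp ((C * potential x y + 1)\<^sup>2)"
    if "(x, y, t) \<in> strip t0 T" for x y t
    using assms(20)[OF that] unfolding potential_def by linarith+
  note growth = this
  show "u1 p \<le> u2 p"
    by (rule cauchy_solution_le[where a = a and b = b and \<Lambda> = \<Lambda> and \<phi> = \<phi> and C = C and M = M])
       (fact assms a growth p)+
  show "u2 p \<le> u1 p"
    by (rule cauchy_solution_le[where a = a and b = b and \<Lambda> = \<Lambda> and \<phi> = \<phi> and C = C and M = M])
       (fact assms a growth p)+
qed

end
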